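(* If $\sigma\subset\mathbb{C}$ is nonempty and compact, then $C^2(\sigma)\subseteq AC(\sigma)$.
   Context: Identify $\mathbb{C}$ with $\mathbb{R}^2$. A list $S=[x_0,x_1,\dots,x_n]$ ($n\ge 0$) is a finite ordered list of points of the plane; repetitions are allowed. For a line $\ell$ in the plane and $n\ge 1$, the segment $\overline{x_j\,x_{j+1}}$ ($0\le j<n$) is a crossing segment of $S$ on $\ell$ if one of the following holds: (1) $x_j$ and $x_{j+1}$ lie on strictly opposite sides of $\ell$; (2) $j=0$ and $x_0\in\ell$; (3) $x_j\notin\ell$ and $x_{j+1}\in\ell$. Let $\mathrm{vf}(S,\ell)$ be the number of crossing segments of $S$ on $\ell$ (counted by index $j$); for $n=0$ put $\mathrm{vf}([x_0],\ell)=1$ if $x_0\in\ell$ and $0$ otherwise. The variation factor is $\mathrm{vf}(S)=\max_\ell \mathrm{vf}(S,\ell)$, the maximum over all lines in the plane. For a nonempty compact set $\sigma$ in the plane, $f:\sigma\to\mathbb{C}$ and a list $S=[x_0,\dots,x_n]$ of elements of $\sigma$, put $\mathrm{cvar}(f,S)=\sum_{i=1}^n|f(x_i)-f(x_{i-1})|$ (equal to $0$ if $n=0$), and $\mathrm{var}(f,\sigma)=\sup_S \mathrm{cvar}(f,S)/\mathrm{vf}(S)\in[0,\infty]$, the supremum over all finite ordered lists of elements of $\sigma$. Put $\|f\|_{BV(\sigma)}=\|f\|_\infty+\mathrm{var}(f,\sigma)$ with $\|f\|_\infty=\sup_{z\in\sigma}|f(z)|$, and $BV(\sigma)=\{f:\sigma\to\mathbb{C}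 : \|f\|_{BV(\sigma)}<\infty\}$. Let $\mathcal{P}_2$ be the algebra of functions on $\sigma$ of the form $p(x,y)=\sum_{m,n=0}^N c_{mn}x^my^n$ with $c_{mn}\in\mathbb{C}$ (complex polynomials in the two real coordinates); these all lie in $BV(\sigma)$. $AC(\sigma)$ is the closure of $\mathcal{P}_2$ in $(BV(\sigma),\|\cdot\|_{BV(\sigma)})$. $C^2(\sigma)$ is the vector space of all $f:\sigma\to\mathbb{C}$ for which there exist an open neighbourhood $U$ of $\sigma$ in $\mathbb{R}^2$ and an extension $F:U\to\mathbb{C}$ of $f$ with $F\in C^2(U)$ (in the sense of real differentiability). *)

theory Defs
  imports "HOL-Analysis.Analysis"
begin

text \<open>
  A function on \<open>\<sigma>\<close> is represented by a total function \<open>complex \<Rightarrow> complex\<close> of which only the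
  values on \<open>\<sigma>\<close> matter: all sets of functions below are closed under changing a function
  outside \<open>\<sigma>\<close>, so inclusions between them are inclusions between sets of functions on \<open>\<sigma>\<close>.

  The lines of the plane are the sets \<open>line u c\<close> with \<open>u \<noteq> 0\<close>; the two open half-planes
  \<open>u \<bullet> z < c\<close> and \<open>u \<bullet> z > c\<close> are the sides of \<open>line u c\<close>.
\<close>

definition line :: "complex \<Rightarrow> real \<Rightarrow> complex set" where
  "line u c = {z. u \<bullet> z = c}"

definition strictly_opposite_sides :: "complex \<Rightarrow> real \<Rightarrow> complex \<Rightarrow> complex \<Rightarrow> bool" where
  "strictly_opposite_sides u c x y \<longleftrightarrow>
     u \<bullet> x < c \<and> c < u \<bullet> y \<or> u \<bullet> y < c \<and> c < u \<bullet> x"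

definition crossing_segment :: "complex list \<Rightarrow> complex \<Rightarrow> real \<Rightarrow> nat \<Rightarrow> bool" where
  "crossing_segment S u c j \<longleftrightarrow>
     strictly_opposite_sides u c (S ! j) (S ! Suc j) \<or>
     j = 0 \<and> S ! 0 \<in> line u c \<or>
     S ! j \<notin> line u c \<and> S ! Suc j \<in> line u c"

definition vf_on :: "complex list \<Rightarrow> complex \<Rightarrow> real \<Rightarrow> nat" where
  "vf_on S u c =
     (if length S = 1 then (if S ! 0 \<in> line u c then 1 else 0)
      else card {j. Suc j < length S \<and> crossing_segment S u c j})"

definition vf :: "complex list \<Rightarrow> nat" where
  "vf S = Max {vf_on S u c | u c. u \<noteq> 0}"

text \<open>The maximum is taken over a finite nonempty set, hence is a genuine maximum.\<close>

lemma vf_on_le_length: "vf_on S u c \<le> length S"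
proof (cases "length S = 1")
  case True
  then show ?thesis by (simp add: vf_on_def)
next
  case False
  have "card {j. Suc j < length S \<and> crossing_segment S u c j} \<le> card {..<length S}"
    by (rule card_mono) auto
  with False show ?thesis by (simp add: vf_on_def)
qed

lemma finite_vf_on_values: "finite {vf_on S u c | u c. u \<noteq> 0}"
  by (rule finite_subset[of _ "{..length S}"]) (auto simp: vf_on_le_length)

lemma vf_on_values_nonempty: "{vf_on S u c | u c. u \<noteq> 0} \<noteq> {}"
  using zero_neq_one by blast

lemma vf_pos:
  assumes "S \<noteq> []"
  shows "0 < vf S"
proof -
  let ?c = "1 \<bullet> (S ! 0)"
  have "0 < vf_on S 1 ?c"
  proof (cases "length S = 1")
    case True
    then show ?thesis by (simp add: vf_on_def line_def)
  next
    case False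
    with assms have "Suc 0 < length S" by (cases S) auto
    then have "0 \<in> {j. Suc j < length S \<and> crossing_segment S 1 ?c j}"
      by (simp add: crossing_segment_def line_def)
    moreover have "finite {j. Suc j < length S \<and> crossing_segment S 1 ?c j}"
      by (rule finite_subset[of _ "{..<length S}"]) auto
    ultimately have "0 < card {j. Suc j < length S \<and> crossing_segment S 1 ?c j}"
      by (auto simp: card_gt_0_iff)
    with False show ?thesis by (simp add: vf_on_def)
  qed
  also have "vf_on S 1 ?c \<le> vf S"
    unfolding vf_def by (rule Max_ge[OF finite_vf_on_values]) (use zero_neq_one in force)
  finally show ?thesis .
qed

definition cvar :: "(complex \<Rightarrow> complex) \<Rightarrow> complex list \<Rightarrow> real" where
  "cvar f S = (\<Sum>i = 1..<length S. cmod (f (S ! i) - f (S ! (i - 1))))"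

definition variation :: "complex set \<Rightarrow> (complex \<Rightarrow> complex) \<Rightarrow> ennreal" where
  "variation \<sigma> f = (SUP S \<in> {S. S \<noteq> [] \<and> set S \<subseteq> \<sigma>}. ennreal (cvar f S / real (vf S)))"

definition sup_norm :: "complex set \<Rightarrow> (complex \<Rightarrow> complex) \<Rightarrow> ennreal" where
  "sup_norm \<sigma> f = (SUP z \<in> \<sigma>. ennreal (cmod (f z)))"

definition BV_norm :: "complex set \<Rightarrow> (complex \<Rightarrow> complex) \<Rightarrow> ennreal" where
  "BV_norm \<sigma> f = sup_norm \<sigma> f + variation \<sigma> f"

definition BV :: "complex set \<Rightarrow> (complex \<Rightarrow> complex) set" where
  "BV \<sigma> = {f. BV_norm \<sigma> f < \<infinity>}"

definition P2 :: "complex set \<Rightarrow> (complex \<Rightarrow> complex) set" where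
  "P2 \<sigma> = {p. \<exists>(N :: nat) (c :: nat \<Rightarrow> nat \<Rightarrow> complex). \<forall>z \<in> \<sigma>.
     p z = (\<Sum>m\<le>N. \<Sum>n\<le>N. c m n * of_real (Re z) ^ m * of_real (Im z) ^ n)}"

definition AC :: "complex set \<Rightarrow> (complex \<Rightarrow> complex) set" where
  "AC \<sigma> = {f \<in> BV \<sigma>. \<forall>\<epsilon> > 0. \<exists>p \<in> P2 \<sigma>. BV_norm \<sigma> (\<lambda>z. f z - p z) < ennreal \<epsilon>}"

text \<open>
  Real differentiability: \<open>F'\<close> and \<open>F''\<close> are the first and second Frechet derivatives over the
  reals, the bounded linear maps between complex spaces being only real-linear.
\<close>

definition C2_differentiable_on :: "(complex \<Rightarrow> complex) \<Rightarrow> complex set \<Rightarrow> bool" where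
  "C2_differentiable_on F U \<longleftrightarrow>
     (\<exists>(F' :: complex \<Rightarrow> complex \<Rightarrow>\<^sub>L complex) (F'' :: complex \<Rightarrow> complex \<Rightarrow>\<^sub>L complex \<Rightarrow>\<^sub>L complex).
        (\<forall>z \<in> U. (F has_derivative blinfun_apply (F' z)) (at z)) \<and>
        (\<forall>z \<in> U. (F' has_derivative blinfun_apply (F'' z)) (at z)) \<and>
        continuous_on U F'')"

definition C2_functions :: "complex set \<Rightarrow> (complex \<Rightarrow> complex) set" where
  "C2_functions \<sigma> = {f. \<exists>U F. open U \<and> \<sigma> \<subseteq> U \<and> C2_differentiable_on F U \<and> (\<forall>z \<in> \<sigma>. F z = f z)}"

end

theory Submission
  imports Defs
begin

text \<open>
  A vertical line \<open>Re = t\<close> is crossed by at most \<open>vf S\<close> segments of \<open>S\<close>; integrating over \<open>t\<close>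
  bounds the total horizontal displacement along \<open>S\<close> by the width of \<open>\<sigma>\<close> times \<open>vf S\<close>, and
  likewise vertically. Hence the variation of a function is at most a constant times its Lipschitz
  constant on \<open>\<sigma>\<close>.

  Multiplying by a cutoff extends a \<open>C\<^sup>2\<close> function to a function \<open>G\<close> on the whole plane with
  continuous \<open>G\<^sub>x\<close>, \<open>G\<^sub>y\<close>, \<open>G\<^sub>x\<^sub>y\<close>. On a square around \<open>\<sigma>\<close> the Lipschitz constant of such a
  function is controlled by \<open>G\<^sub>x\<close> and \<open>G\<^sub>y\<close> on the axes and by \<open>G\<^sub>x\<^sub>y\<close>. By Stone-Weierstrass these
  three are uniformly approximated by polynomials, which are integrated to a polynomial \<open>p\<close> such
  that \<open>G - p\<close> has small norm.
\<close>

subsection \<open>Variation of Lipschitz functions\<close>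

lemma vf_on_le_vf: "u \<noteq> 0 \<Longrightarrow> vf_on S u c \<le> vf S"
  unfolding vf_def by (rule Max_ge[OF finite_vf_on_values]) blast

text \<open>A segment whose endpoints straddle \<open>t\<close> strictly is a crossing segment on
  \<open>line u t\<close> by the first clause of the definition. Taking open intervals loses only
  finitely many values of \<open>t\<close>, which do not matter after integration.\<close>

lemma card_straddling_le_vf:
  assumes "u \<noteq> 0"
  shows "card {i \<in> {1..<length S}. t \<in> {min (u \<bullet> S ! (i - 1)) (u \<bullet> S ! i)<..<
    max (u \<bullet> S ! (i - 1)) (u \<bullet> S ! i)}} \<le> vf S" (is "card ?I \<le> _")
proof (cases "length S \<le> 1")
  case True
  then show ?thesis by simp
next
  case False
  let ?J = "{j. Suc j < length S \<and> crossing_segment S u t j}"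
  \<comment> \<open>\<open>cvar\<close> numbers a segment by its right endpoint,
    \<open>crossing_segment\<close> by its left one.\<close>
  have "?I \<subseteq> Suc ` ?J"
  proof
    fix i assume i: "i \<in> ?I"
    then obtain j where j: "i = Suc j"
      by (cases i) auto
    have "j \<in> ?J"
      using i unfolding j crossing_segment_def strictly_opposite_sides_def
      by (auto simp: min_def max_def split: if_splits)
    with j show "i \<in> Suc ` ?J" by blast
  qed
  moreover have "finite ?J"
    by (rule finite_subset[of _ "{..<length S}"]) auto
  ultimately have "card ?I \<le> card ?J"
    by (rule surj_card_le[rotated])
  also have "\<dots> = vf_on S u t"
    using False by (simp add: vf_on_def)
  also have "\<dots> \<le> vf S"
    by (rule vf_on_le_vf[OF assms])
  finally show ?thesis .
qed

text \<open>Each summand is the integral of the indicator of the interval \<open>J i\<close>. After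
  exchanging sum and integral, the integrand counts the segments straddling \<open>t\<close>: it is
  at most \<open>vf S\<close>, and it vanishes outside \<open>{-L..L}\<close>, an interval of length
  \<open>2 * L\<close>.\<close>

lemma sum_abs_inner_diff_le_vf:
  assumes u: "u \<noteq> 0" and S: "\<And>z. z \<in> set S \<Longrightarrow> \<bar>u \<bullet> z\<bar> \<le> L" and "0 \<le> L"
  shows "(\<Sum>i = 1..<length S. \<bar>u \<bullet> S ! i - u \<bullet> S ! (i - 1)\<bar>) \<le> 2 * L * vf S"
proof -
  define J where "J i = {min (u \<bullet> S ! (i - 1)) (u \<bullet> S ! i)<..<max (u \<bullet> S ! (i - 1)) (u \<bullet> S ! i)}" for i
  let ?I = "{1..<length S}"
  have J_sub: "J i \<subseteq> {-L..L}" if "i \<in> ?I" for i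
  proof -
    have "\<bar>u \<bullet> S ! i\<bar> \<le> L" "\<bar>u \<bullet> S ! (i - 1)\<bar> \<le> L"
      using that by (auto intro!: S nth_mem)
    then show ?thesis
      unfolding J_def by (auto simp: min_def max_def split: if_splits)
  qed
  have length_J: "\<bar>u \<bullet> S ! i - u \<bullet> S ! (i - 1)\<bar> = (\<integral>t. indicator (J i) t \<partial>lborel)" for i
    by (auto simp: J_def min_def max_def)
  have integrable_J: "integrable lborel (indicator (J i) :: real \<Rightarrow> real)" for i
    by (simp add: J_def emeasure_lborel_box_eq min_def max_def)
  have count_le: "(\<Sum>i\<in>?I. indicator (J i) t :: real) \<le> vf S * indicat_real {-L..L} t" for t :: real
  proof (cases "t \<in> {-L..L}")
    case True
    have "(\<Sum>i\<in>?I. indicator (J i) t) = real (card {i \<in> ?I. t \<in> J i})"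
      by (simp add: indicator_def sum.If_cases Int_def)
    with True show ?thesis
      using card_straddling_le_vf[OF u, of S t] by (simp add: J_def)
  next
    case False
    then have "(\<Sum>i\<in>?I. indicator (J i) t) = (0 :: real)"
      using J_sub by (intro sum.neutral) (meson indicator_simps(2) subsetD)
    with False show ?thesis by simp
  qed
  have integrable_Icc: "integrable lborel (indicator {-L..L} :: real \<Rightarrow> real)"
    by (simp add: integrable_indicator_iff emeasure_lborel_Icc_eq)
  have "(\<Sum>i\<in>?I. \<bar>u \<bullet> S ! i - u \<bullet> S ! (i - 1)\<bar>) = (\<integral>t. (\<Sum>i\<in>?I. indicator (J i) t) \<partial>lborel)"
    unfolding length_J by (rule Bochner_Integration.integral_sum[symmetric]) (rule integrable_J)
  also have "\<dots> \<le> (\<integral>t. vf S * indicat_real {-L..L} t \<partial>lborel)"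
    using count_le integrable_J integrable_Icc
    by (intro integral_mono Bochner_Integration.integrable_sum) auto
  also have "\<dots> = 2 * L * vf S"
    using \<open>0 \<le> L\<close> by simp
  finally show ?thesis .
qed

text \<open>The directions \<open>1\<close> and \<open>\<i>\<close> turn inner products into real
  and imaginary parts. Each of them contributes \<open>2 * L * vf S\<close>, and the division by
  \<open>vf S\<close> leaves a bound that is uniform in \<open>S\<close>.\<close>

lemma variation_le_Lipschitz:
  assumes \<sigma>: "\<And>z. z \<in> \<sigma> \<Longrightarrow> \<bar>Re z\<bar> \<le> L \<and> \<bar>Im z\<bar> \<le> L" and "0 \<le> L" and "0 \<le> K"
    and lip: "\<And>z w. z \<in> \<sigma> \<Longrightarrow> w \<in> \<sigma> \<Longrightarrow> cmod (f z - f w) \<le> K * (\<bar>Re z - Re w\<bar> + \<bar>Im z - Im w\<bar>)"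
  shows "variation \<sigma> f \<le> ennreal (4 * L * K)"
  unfolding variation_def
proof (rule SUP_least)
  fix S assume "S \<in> {S. S \<noteq> [] \<and> set S \<subseteq> \<sigma>}"
  then have S: "S \<noteq> []" "set S \<subseteq> \<sigma>" by auto
  have re: "(\<Sum>i = 1..<length S. \<bar>Re (S ! i) - Re (S ! (i - 1))\<bar>) \<le> 2 * L * vf S"
    using sum_abs_inner_diff_le_vf[of 1 S L] S \<sigma> \<open>0 \<le> L\<close> by (auto simp: inner_complex_def)
  have im: "(\<Sum>i = 1..<length S. \<bar>Im (S ! i) - Im (S ! (i - 1))\<bar>) \<le> 2 * L * vf S"
    using sum_abs_inner_diff_le_vf[of \<i> S L] S \<sigma> \<open>0 \<le> L\<close> by (auto simp: inner_complex_def)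
  have "cvar f S \<le> (\<Sum>i = 1..<length S. K * (\<bar>Re (S ! i) - Re (S ! (i - 1))\<bar> + \<bar>Im (S ! i) - Im (S ! (i - 1))\<bar>))"
    unfolding cvar_def using S(2) by (intro sum_mono lip) (auto simp: subset_iff)
  also have "\<dots> = K * ((\<Sum>i = 1..<length S. \<bar>Re (S ! i) - Re (S ! (i - 1))\<bar>) +
      (\<Sum>i = 1..<length S. \<bar>Im (S ! i) - Im (S ! (i - 1))\<bar>))"
    by (simp only: sum.distrib[symmetric] sum_distrib_left)
  also have "\<dots> \<le> K * (2 * L * vf S + 2 * L * vf S)"
    using re im \<open>0 \<le> K\<close> by (intro mult_left_mono add_mono)
  finally have "cvar f S \<le> 4 * L * K * vf S"
    by (simp add: algebra_simps)
  then have "cvar f S / vf S \<le> 4 * L * K"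
    using vf_pos[OF S(1)] by (simp add: divide_le_eq)
  then show "ennreal (cvar f S / vf S) \<le> ennreal (4 * L * K)"
    by (rule ennreal_leI)
qed

lemma BV_norm_le_Lipschitz:
  assumes \<sigma>: "\<And>z. z \<in> \<sigma> \<Longrightarrow> \<bar>Re z\<bar> \<le> L \<and> \<bar>Im z\<bar> \<le> L" and "0 \<le> L" and "0 \<le> K" and "0 \<le> M"
    and lip: "\<And>z w. z \<in> \<sigma> \<Longrightarrow> w \<in> \<sigma> \<Longrightarrow> cmod (f z - f w) \<le> K * (\<bar>Re z - Re w\<bar> + \<bar>Im z - Im w\<bar>)"
    and bd: "\<And>z. z \<in> \<sigma> \<Longrightarrow> cmod (f z) \<le> M"
  shows "BV_norm \<sigma> f \<le> ennreal (M + 4 * L * K)"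
proof -
  have "sup_norm \<sigma> f \<le> ennreal M"
    unfolding sup_norm_def by (rule SUP_least) (rule ennreal_leI[OF bd])
  moreover have "variation \<sigma> f \<le> ennreal (4 * L * K)"
    using variation_le_Lipschitz[of \<sigma> L K f] assms by blast
  ultimately have "BV_norm \<sigma> f \<le> ennreal M + ennreal (4 * L * K)"
    unfolding BV_norm_def by (rule add_mono)
  also have "\<dots> = ennreal (M + 4 * L * K)"
    using assms by (simp add: ennreal_plus)
  finally show ?thesis .
qed

text \<open>Allows \<open>f\<close> to be replaced by an extension of it to the plane.\<close>

lemma BV_norm_cong:
  assumes "\<And>z. z \<in> \<sigma> \<Longrightarrow> f z = g z"
  shows "BV_norm \<sigma> f = BV_norm \<sigma> g"
proof -
  have "sup_norm \<sigma> f = sup_norm \<sigma> g"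
    unfolding sup_norm_def using assms by (intro SUP_cong) auto
  moreover have "cvar f S = cvar g S" if "set S \<subseteq> \<sigma>" for S
    unfolding cvar_def using assms that by (intro sum.cong) (auto simp: subset_iff)
  then have "variation \<sigma> f = variation \<sigma> g"
    unfolding variation_def by (intro SUP_cong) auto
  ultimately show ?thesis by (simp add: BV_norm_def)
qed

subsection \<open>Functions with a continuous mixed derivative\<close>

text \<open>The arguments stand for a function \<open>g\<close> of \<open>z = x + \<i> y\<close> and its partial derivatives
  \<open>g\<^sub>x\<close>, \<open>g\<^sub>y\<close> and \<open>(g\<^sub>x)\<^sub>y\<close>.\<close>

definition mixed_derivs :: "complex set \<Rightarrow> (complex \<Rightarrow> complex) \<Rightarrow> (complex \<Rightarrow> complex) \<Rightarrow>
    (complex \<Rightarrow> complex) \<Rightarrow> (complex \<Rightarrow> complex) \<Rightarrow> bool" where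
  "mixed_derivs U g gx gy gxy \<longleftrightarrow>
    (\<forall>z\<in>U. ((\<lambda>t. g (Complex t (Im z))) has_vector_derivative gx z) (at (Re z)) \<and>
      ((\<lambda>t. g (Complex (Re z) t)) has_vector_derivative gy z) (at (Im z)) \<and>
      ((\<lambda>t. gx (Complex (Re z) t)) has_vector_derivative gxy z) (at (Im z))) \<and>
    continuous_on U g \<and> continuous_on U gx \<and> continuous_on U gy \<and> continuous_on U gxy"

lemma mixed_derivs_UNIV_D:
  assumes "mixed_derivs UNIV g gx gy gxy"
  shows "((\<lambda>t. g (Complex t y)) has_vector_derivative gx (Complex x y)) (at x)"
    and "((\<lambda>t. g (Complex x t)) has_vector_derivative gy (Complex x y)) (at y)"
    and "((\<lambda>t. gx (Complex x t)) has_vector_derivative gxy (Complex x y)) (at y)"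
  using assms[unfolded mixed_derivs_def, THEN conjunct1, THEN bspec, of "Complex x y"] by simp_all

section \<open>Algebra of mixed derivatives\<close>

lemma mixed_derivs_subset: "mixed_derivs V g gx gy gxy \<Longrightarrow> U \<subseteq> V \<Longrightarrow> mixed_derivs U g gx gy gxy"
  unfolding mixed_derivs_def by (blast intro: continuous_on_subset)

lemma mixed_derivs_const: "mixed_derivs U (\<lambda>z. c) (\<lambda>z. 0) (\<lambda>z. 0) (\<lambda>z. 0)"
  unfolding mixed_derivs_def by auto

lemma mixed_derivs_add:
  assumes "mixed_derivs U g gx gy gxy" "mixed_derivs U h hx hy hxy"
  shows "mixed_derivs U (\<lambda>z. g z + h z) (\<lambda>z. gx z + hx z) (\<lambda>z. gy z + hy z) (\<lambda>z. gxy z + hxy z)"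
  using assms unfolding mixed_derivs_def
  by (auto intro!: continuous_intros has_vector_derivative_add)

lemma mixed_derivs_diff:
  assumes "mixed_derivs U g gx gy gxy" "mixed_derivs U h hx hy hxy"
  shows "mixed_derivs U (\<lambda>z. g z - h z) (\<lambda>z. gx z - hx z) (\<lambda>z. gy z - hy z) (\<lambda>z. gxy z - hxy z)"
  using assms unfolding mixed_derivs_def
  by (auto intro!: continuous_intros has_vector_derivative_diff)

text \<open>The fourth function is the product rule in \<open>y\<close> applied to the two summands
  \<open>g z * hx z\<close> and \<open>gx z * h z\<close> of the second.\<close>

lemma mixed_derivs_mult:
  assumes "mixed_derivs U g gx gy gxy" "mixed_derivs U h hx hy hxy"
  shows "mixed_derivs U (\<lambda>z. g z * h z) (\<lambda>z. g z * hx z + gx z * h z) (\<lambda>z. g z * hy z + gy z * h z)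
    (\<lambda>z. (g z * hxy z + gy z * hx z) + (gx z * hy z + gxy z * h z))"
proof -
  have g: "continuous_on U g" "continuous_on U gx" "continuous_on U gy" "continuous_on U gxy"
    and h: "continuous_on U h" "continuous_on U hx" "continuous_on U hy" "continuous_on U hxy"
    using assms unfolding mixed_derivs_def by auto
  have "((\<lambda>t. g (Complex t (Im z)) * h (Complex t (Im z))) has_vector_derivative g z * hx z + gx z * h z) (at (Re z))"
    and "((\<lambda>t. g (Complex (Re z) t) * h (Complex (Re z) t)) has_vector_derivative g z * hy z + gy z * h z) (at (Im z))"
    and "((\<lambda>t. g (Complex (Re z) t) * hx (Complex (Re z) t) + gx (Complex (Re z) t) * h (Complex (Re z) t))
      has_vector_derivative (g z * hxy z + gy z * hx z) + (gx z * hy z + gxy z * h z)) (at (Im z))"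
    if "z \<in> U" for z
  proof -
    have gz: "((\<lambda>t. g (Complex t (Im z))) has_vector_derivative gx z) (at (Re z))"
      "((\<lambda>t. g (Complex (Re z) t)) has_vector_derivative gy z) (at (Im z))"
      "((\<lambda>t. gx (Complex (Re z) t)) has_vector_derivative gxy z) (at (Im z))"
      and hz: "((\<lambda>t. h (Complex t (Im z))) has_vector_derivative hx z) (at (Re z))"
      "((\<lambda>t. h (Complex (Re z) t)) has_vector_derivative hy z) (at (Im z))"
      "((\<lambda>t. hx (Complex (Re z) t)) has_vector_derivative hxy z) (at (Im z))"
      using assms that unfolding mixed_derivs_def by blast+
    show "((\<lambda>t. g (Complex t (Im z)) * h (Complex t (Im z))) has_vector_derivative g z * hx z + gx z * h z) (at (Re z))"
      using has_vector_derivative_mult[OF gz(1) hz(1)] by simp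
    show "((\<lambda>t. g (Complex (Re z) t) * h (Complex (Re z) t)) has_vector_derivative g z * hy z + gy z * h z) (at (Im z))"
      using has_vector_derivative_mult[OF gz(2) hz(2)] by simp
    show "((\<lambda>t. g (Complex (Re z) t) * hx (Complex (Re z) t) + gx (Complex (Re z) t) * h (Complex (Re z) t))
      has_vector_derivative (g z * hxy z + gy z * hx z) + (gx z * hy z + gxy z * h z)) (at (Im z))"
      using has_vector_derivative_add[OF has_vector_derivative_mult[OF gz(2) hz(3)]
          has_vector_derivative_mult[OF gz(3) hz(2)]] by simp
  qed
  with g h show ?thesis
    unfolding mixed_derivs_def by (intro conjI ballI continuous_intros)
qed

text \<open>The source of the explicit examples: monomials and local bumps are products of a
  function of \<open>Re z\<close> and a function of \<open>Im z\<close>. The mixed derivative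
  differentiates each factor once, so C1 factors suffice.\<close>

lemma mixed_derivs_tensor:
  fixes \<phi> \<psi> :: "real \<Rightarrow> complex"
  assumes \<phi>: "\<And>t. (\<phi> has_vector_derivative \<phi>' t) (at t)" "continuous_on UNIV \<phi>'"
    and \<psi>: "\<And>t. (\<psi> has_vector_derivative \<psi>' t) (at t)" "continuous_on UNIV \<psi>'"
  shows "mixed_derivs UNIV (\<lambda>z. \<phi> (Re z) * \<psi> (Im z)) (\<lambda>z. \<phi>' (Re z) * \<psi> (Im z))
    (\<lambda>z. \<phi> (Re z) * \<psi>' (Im z)) (\<lambda>z. \<phi>' (Re z) * \<psi>' (Im z))"
proof -
  have cont: "continuous_on UNIV \<phi>" "continuous_on UNIV \<psi>"
    using \<phi>(1) \<psi>(1) by (meson continuous_at_imp_continuous_on has_vector_derivative_continuous)+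
  have comp: "continuous_on UNIV (\<lambda>z. f (Re z))" "continuous_on UNIV (\<lambda>z. f (Im z))"
    if "continuous_on UNIV f" for f :: "real \<Rightarrow> complex"
    by (rule continuous_on_compose2[OF that]; auto intro: continuous_intros)+
  show ?thesis
    unfolding mixed_derivs_def
    using \<phi> \<psi> cont comp
    by (auto intro!: continuous_on_mult has_vector_derivative_mult_left has_vector_derivative_mult_right)
qed

section \<open>Locality and extension by zero\<close>

lemma open_slices:
  assumes "open U"
  shows "open {t. Complex t y \<in> U}" "open {t. Complex x t \<in> U}"
proof -
  have "continuous_on UNIV (\<lambda>t. Complex t y)" "continuous_on UNIV (\<lambda>t. Complex x t)"
    unfolding Complex_eq by (auto intro!: continuous_intros)
  from this[THEN open_vimage[OF assms]] show "open {t. Complex t y \<in> U}" "open {t. Complex x t \<in> U}"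
    by (auto simp: vimage_def)
qed

lemma has_vector_derivative_slice_cong:
  assumes "open U" "z \<in> U" "\<And>w. w \<in> U \<Longrightarrow> f w = g w"
  shows "((\<lambda>t. f (Complex t (Im z))) has_vector_derivative d) (at (Re z)) \<Longrightarrow>
      ((\<lambda>t. g (Complex t (Im z))) has_vector_derivative d) (at (Re z))"
    and "((\<lambda>t. f (Complex (Re z) t)) has_vector_derivative d) (at (Im z)) \<Longrightarrow>
      ((\<lambda>t. g (Complex (Re z) t)) has_vector_derivative d) (at (Im z))"
proof -
  assume "((\<lambda>t. f (Complex t (Im z))) has_vector_derivative d) (at (Re z))"
  then show "((\<lambda>t. g (Complex t (Im z))) has_vector_derivative d) (at (Re z))"
    by (rule has_vector_derivative_transform_within_open[OF _ open_slices(1)[OF assms(1), of "Im z"]])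
      (simp_all add: complex_surj assms(2,3))
next
  assume "((\<lambda>t. f (Complex (Re z) t)) has_vector_derivative d) (at (Im z))"
  then show "((\<lambda>t. g (Complex (Re z) t)) has_vector_derivative d) (at (Im z))"
    by (rule has_vector_derivative_transform_within_open[OF _ open_slices(2)[OF assms(1), of "Re z"]])
      (simp_all add: complex_surj assms(2,3))
qed

lemma mixed_derivs_cong:
  assumes "open U" "mixed_derivs U g gx gy gxy"
    and eq: "\<And>z. z \<in> U \<Longrightarrow> g z = h z" "\<And>z. z \<in> U \<Longrightarrow> gx z = hx z"
      "\<And>z. z \<in> U \<Longrightarrow> gy z = hy z" "\<And>z. z \<in> U \<Longrightarrow> gxy z = hxy z"
  shows "mixed_derivs U h hx hy hxy"
  using assms(2) unfolding mixed_derivs_def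
proof (elim conjE, intro conjI ballI)
  fix z assume z: "z \<in> U" and *: "\<forall>z\<in>U. ((\<lambda>t. g (Complex t (Im z))) has_vector_derivative gx z) (at (Re z)) \<and>
      ((\<lambda>t. g (Complex (Re z) t)) has_vector_derivative gy z) (at (Im z)) \<and>
      ((\<lambda>t. gx (Complex (Re z) t)) has_vector_derivative gxy z) (at (Im z))"
  show "((\<lambda>t. h (Complex t (Im z))) has_vector_derivative hx z) (at (Re z))"
    using * z eq by (intro has_vector_derivative_slice_cong(1)[OF assms(1) z eq(1)]) auto
  show "((\<lambda>t. h (Complex (Re z) t)) has_vector_derivative hy z) (at (Im z))"
    using * z eq by (intro has_vector_derivative_slice_cong(2)[OF assms(1) z eq(1)]) auto
  show "((\<lambda>t. hx (Complex (Re z) t)) has_vector_derivative hxy z) (at (Im z))"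
    using * z eq by (intro has_vector_derivative_slice_cong(2)[OF assms(1) z eq(2)]) auto
qed (use eq in \<open>simp_all cong: continuous_on_cong\<close>)

lemma mixed_derivs_Un:
  assumes "open U" "open V" "mixed_derivs U g gx gy gxy" "mixed_derivs V g gx gy gxy"
  shows "mixed_derivs (U \<union> V) g gx gy gxy"
  using assms unfolding mixed_derivs_def
  by (intro conjI continuous_on_open_Un) blast+

text \<open>The derivatives enter \<open>mixed_derivs\<close> as arguments, so their vanishing comes
  from the uniqueness of one-dimensional derivatives.\<close>

lemma mixed_derivs_vanish:
  assumes "open U" "mixed_derivs U g gx gy gxy" "\<And>z. z \<in> U \<Longrightarrow> g z = 0" "z \<in> U"
  shows "gx z = 0" "gy z = 0" "gxy z = 0"
proof -
  \<comment> \<open>Proved on all of \<open>U\<close>, because \<open>gxy z\<close> is a derivative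
    of \<open>gx\<close> along a slice through \<open>z\<close>.\<close>
  have x: "gx w = 0" if "w \<in> U" for w
  proof (rule vector_derivative_unique_at)
    show "((\<lambda>t. g (Complex t (Im w))) has_vector_derivative gx w) (at (Re w))"
      using assms(2) that unfolding mixed_derivs_def by blast
    show "((\<lambda>t. g (Complex t (Im w))) has_vector_derivative 0) (at (Re w))"
      by (rule has_vector_derivative_slice_cong(1)[OF assms(1) that, of "\<lambda>_. 0"]) (simp_all add: assms(3))
  qed
  show "gx z = 0" by (rule x[OF assms(4)])
  show "gy z = 0"
  proof (rule vector_derivative_unique_at)
    show "((\<lambda>t. g (Complex (Re z) t)) has_vector_derivative gy z) (at (Im z))"
      using assms(2,4) unfolding mixed_derivs_def by blast
    show "((\<lambda>t. g (Complex (Re z) t)) has_vector_derivative 0) (at (Im z))"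
      by (rule has_vector_derivative_slice_cong(2)[OF assms(1,4), of "\<lambda>_. 0"]) (simp_all add: assms(3))
  qed
  show "gxy z = 0"
  proof (rule vector_derivative_unique_at)
    show "((\<lambda>t. gx (Complex (Re z) t)) has_vector_derivative gxy z) (at (Im z))"
      using assms(2,4) unfolding mixed_derivs_def by blast
    show "((\<lambda>t. gx (Complex (Re z) t)) has_vector_derivative 0) (at (Im z))"
      by (rule has_vector_derivative_slice_cong(2)[OF assms(1,4), of "\<lambda>_. 0"]) (simp_all add: x)
  qed
qed

text \<open>The open sets \<open>U\<close> and \<open>- C\<close> cover the plane. On
  \<open>U\<close> the extension is \<open>g\<close>; on \<open>- C\<close> it is zero together with
  its derivatives, by \<open>mixed_derivs_vanish\<close> on the overlap \<open>U - C\<close> and by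
  the default value elsewhere.\<close>

lemma mixed_derivs_extend_zero:
  assumes "open U" "closed C" "C \<subseteq> U" and g: "mixed_derivs U g gx gy gxy"
    and zero: "\<And>z. z \<in> U - C \<Longrightarrow> g z = 0"
  defines "ext \<equiv> \<lambda>f z. if z \<in> U then f z else (0 :: complex)"
  shows "mixed_derivs UNIV (ext g) (ext gx) (ext gy) (ext gxy)"
proof -
  have "open (U - C)" by (rule open_Diff[OF \<open>open U\<close> \<open>closed C\<close>])
  have "mixed_derivs (U - C) g gx gy gxy"
    by (rule mixed_derivs_subset[OF g]) blast
  note vanish = mixed_derivs_vanish[OF \<open>open (U - C)\<close> this zero]
  have "mixed_derivs U (ext g) (ext gx) (ext gy) (ext gxy)"
    by (rule mixed_derivs_cong[OF \<open>open U\<close> g]) (simp_all add: ext_def)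
  moreover have "mixed_derivs (- C) (ext g) (ext gx) (ext gy) (ext gxy)"
    by (rule mixed_derivs_cong[OF open_Compl[OF \<open>closed C\<close>] mixed_derivs_const[of _ 0]])
      (auto simp: ext_def zero intro: vanish)
  ultimately have "mixed_derivs (U \<union> - C) (ext g) (ext gx) (ext gy) (ext gxy)"
    using \<open>open U\<close> \<open>closed C\<close> by (intro mixed_derivs_Un) auto
  moreover have "U \<union> - C = UNIV" using \<open>C \<subseteq> U\<close> by blast
  ultimately show ?thesis by simp
qed

section \<open>Norm estimate from the mixed derivative\<close>

lemma norm_diff_le_vector_derivative:
  fixes f :: "real \<Rightarrow> complex"
  assumes "\<And>t. (f has_vector_derivative f' t) (at t)" "\<And>t. \<bar>t\<bar> \<le> L \<Longrightarrow> cmod (f' t) \<le> B"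
    and "\<bar>s\<bar> \<le> L" "\<bar>t\<bar> \<le> L"
  shows "cmod (f s - f t) \<le> B * \<bar>s - t\<bar>"
proof -
  have "norm (f s - f t) \<le> B * norm (s - t)"
  proof (rule differentiable_bound[of "{-L..L}" f "\<lambda>t h. h *\<^sub>R f' t"])
    show "(f has_derivative (\<lambda>h. h *\<^sub>R f' t)) (at t within {-L..L})" for t
      using has_vector_derivative_at_within[OF assms(1)] by (simp add: has_vector_derivative_def)
    show "onorm (\<lambda>h. h *\<^sub>R f' t) \<le> B" if "t \<in> {-L..L}" for t
      using assms(2)[of t] that by (auto simp: onorm_scaleR_left onorm_id abs_le_iff)
  qed (use assms in auto)
  then show ?thesis by simp
qed

text \<open>Repeated use of the mean value inequality: \<open>gxy\<close> carries the bound for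
  \<open>gx\<close> from the real axis to the whole square, which controls horizontal increments of
  \<open>g\<close>; vertical increments are compared with those on the imaginary axis. All estimates
  run on the full square, since \<sigma> may be disconnected.\<close>

lemma BV_norm_le_mixed_derivs:
  assumes g: "mixed_derivs UNIV g gx gy gxy"
    and \<sigma>: "\<And>z. z \<in> \<sigma> \<Longrightarrow> \<bar>Re z\<bar> \<le> L \<and> \<bar>Im z\<bar> \<le> L" and "0 \<le> L" and "0 \<le> e"
    and g0: "cmod (g 0) \<le> e"
    and gx: "\<And>x. \<bar>x\<bar> \<le> L \<Longrightarrow> cmod (gx (Complex x 0)) \<le> e"
    and gy: "\<And>y. \<bar>y\<bar> \<le> L \<Longrightarrow> cmod (gy (Complex 0 y)) \<le> e"
    and gxy: "\<And>x y. \<bar>x\<bar> \<le> L \<Longrightarrow> \<bar>y\<bar> \<le> L \<Longrightarrow> cmod (gxy (Complex x y)) \<le> e"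
  shows "BV_norm \<sigma> g \<le> ennreal (e * (1 + 6 * L * (1 + L)))"
proof -
  note D = mixed_derivs_UNIV_D[OF g]
  have gx_diff: "cmod (gx (Complex x y) - gx (Complex x y')) \<le> e * \<bar>y - y'\<bar>"
    if "\<bar>x\<bar> \<le> L" "\<bar>y\<bar> \<le> L" "\<bar>y'\<bar> \<le> L" for x y y'
    by (rule norm_diff_le_vector_derivative[OF D(3)]) (use gxy that in auto)
  have gx_le: "cmod (gx (Complex x y)) \<le> e * (1 + L)" if "\<bar>x\<bar> \<le> L" "\<bar>y\<bar> \<le> L" for x y
  proof -
    have "cmod (gx (Complex x y)) \<le> cmod (gx (Complex x 0)) + cmod (gx (Complex x y) - gx (Complex x 0))"
      by (rule norm_triangle_sub)
    also have "\<dots> \<le> e + e * L"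
      using gx[OF that(1)] gx_diff[OF that, of 0] mult_left_mono[OF that(2) \<open>0 \<le> e\<close>] \<open>0 \<le> L\<close> by simp
    finally show ?thesis by (simp add: algebra_simps)
  qed
  have horizontal: "cmod (g (Complex x y) - g (Complex x' y)) \<le> e * (1 + L) * \<bar>x - x'\<bar>"
    if "\<bar>x\<bar> \<le> L" "\<bar>x'\<bar> \<le> L" "\<bar>y\<bar> \<le> L" for x x' y
    by (rule norm_diff_le_vector_derivative[OF D(1)]) (use gx_le that in auto)
  have axis: "cmod (g (Complex 0 y) - g (Complex 0 y')) \<le> e * \<bar>y - y'\<bar>"
    if "\<bar>y\<bar> \<le> L" "\<bar>y'\<bar> \<le> L" for y y'
    by (rule norm_diff_le_vector_derivative[OF D(2)]) (use gy that in auto)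
  have vertical: "cmod (g (Complex x y) - g (Complex x y')) \<le> e * (1 + L) * \<bar>y - y'\<bar>"
    if "\<bar>x\<bar> \<le> L" "\<bar>y\<bar> \<le> L" "\<bar>y'\<bar> \<le> L" for x y y'
  proof -
    \<comment> \<open>The derivative of \<open>t \<mapsto> g (t, y) - g (t, y')\<close> is controlled by \<open>gxy\<close> alone, so that
      the symmetry of the second derivative is not needed.\<close>
    have "cmod ((g (Complex x y) - g (Complex x y')) - (g (Complex 0 y) - g (Complex 0 y')))
        \<le> e * \<bar>y - y'\<bar> * \<bar>x - 0\<bar>"
      by (rule norm_diff_le_vector_derivative[OF has_vector_derivative_diff[OF D(1) D(1)]])
        (use gx_diff that \<open>0 \<le> L\<close> in auto)
    also have "\<dots> \<le> e * \<bar>y - y'\<bar> * L"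
      using that \<open>0 \<le> e\<close> by (intro mult_left_mono) auto
    finally have "cmod ((g (Complex x y) - g (Complex x y')) - (g (Complex 0 y) - g (Complex 0 y')))
        \<le> e * \<bar>y - y'\<bar> * L" .
    with axis[OF that(2,3)] norm_triangle_sub[of "g (Complex x y) - g (Complex x y')" "g (Complex 0 y) - g (Complex 0 y')"]
    show ?thesis by (simp add: algebra_simps)
  qed
  have lip: "cmod (g z - g w) \<le> e * (1 + L) * (\<bar>Re z - Re w\<bar> + \<bar>Im z - Im w\<bar>)"
    if "\<bar>Re z\<bar> \<le> L" "\<bar>Im z\<bar> \<le> L" "\<bar>Re w\<bar> \<le> L" "\<bar>Im w\<bar> \<le> L" for z w
  proof -
    \<comment> \<open>The path from \<open>z\<close> to \<open>w\<close> turns at a corner that lies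
      in the square but possibly outside \<sigma>.\<close>
    have "cmod (g z - g w) \<le> cmod (g z - g (Complex (Re w) (Im z))) + cmod (g (Complex (Re w) (Im z)) - g w)"
      by (rule norm_diff_triangle_le[OF order_refl order_refl])
    also have "\<dots> \<le> e * (1 + L) * \<bar>Re z - Re w\<bar> + e * (1 + L) * \<bar>Im z - Im w\<bar>"
      using horizontal[of "Re z" "Re w" "Im z"] vertical[of "Re w" "Im z" "Im w"] that
      by (intro add_mono) (simp_all add: complex_surj)
    finally show ?thesis by (simp add: algebra_simps)
  qed
  have bound: "cmod (g z) \<le> e + e * (1 + L) * (2 * L)" if "\<bar>Re z\<bar> \<le> L" "\<bar>Im z\<bar> \<le> L" for z
  proof -
    have "cmod (g z - g 0) \<le> e * (1 + L) * (\<bar>Re z\<bar> + \<bar>Im z\<bar>)"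
      using lip[of z 0] that \<open>0 \<le> L\<close> by simp
    also have "\<dots> \<le> e * (1 + L) * (2 * L)"
      using that \<open>0 \<le> L\<close> \<open>0 \<le> e\<close> by (intro mult_left_mono) auto
    finally show ?thesis
      using norm_triangle_sub[of "g z" "g 0"] g0 by linarith
  qed
  \<comment> \<open>The first two terms bound the supremum, starting from \<open>g 0\<close>; the
    last is \<open>4 * L\<close> times the Lipschitz constant \<open>e * (1 + L)\<close>.\<close>
  have "BV_norm \<sigma> g \<le> ennreal (e + e * (1 + L) * (2 * L) + 4 * L * (e * (1 + L)))"
    using \<sigma> lip bound \<open>0 \<le> L\<close> \<open>0 \<le> e\<close> by (intro BV_norm_le_Lipschitz) auto
  also have "e + e * (1 + L) * (2 * L) + 4 * L * (e * (1 + L)) = e * (1 + 6 * L * (1 + L))"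
    by (simp add: algebra_simps)
  finally show ?thesis .
qed

subsection \<open>Extension of C2 functions to the plane\<close>

text \<open>The chain rule along horizontal and vertical lines expresses the partial derivatives as
  values of \<open>F'\<close> and \<open>F''\<close> at \<open>1\<close> and
  \<open>\<i>\<close>.\<close>

lemma C2_differentiable_mixed_derivs:
  assumes "open U" "C2_differentiable_on F U"
  obtains Fx Fy Fxy where "mixed_derivs U F Fx Fy Fxy"
proof -
  obtain F' :: "complex \<Rightarrow> complex \<Rightarrow>\<^sub>L complex" and F'' :: "complex \<Rightarrow> complex \<Rightarrow>\<^sub>L complex \<Rightarrow>\<^sub>L complex"
    where F': "\<And>z. z \<in> U \<Longrightarrow> (F has_derivative blinfun_apply (F' z)) (at z)"
      and F'': "\<And>z. z \<in> U \<Longrightarrow> (F' has_derivative blinfun_apply (F'' z)) (at z)"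
      and cont: "continuous_on U F''"
    using assms(2) unfolding C2_differentiable_on_def by blast
  have contF: "continuous_on U F" "continuous_on U F'"
    using F' F'' by (meson continuous_at_imp_continuous_on has_derivative_continuous)+
  have Re: "((\<lambda>t. Complex t (Im z)) has_derivative (\<lambda>h. h *\<^sub>R 1)) (at (Re z))" for z
    unfolding Complex_eq by (auto intro!: derivative_eq_intros simp: scaleR_conv_of_real)
  have Im: "((\<lambda>t. Complex (Re z) t) has_derivative (\<lambda>h. h *\<^sub>R \<i>)) (at (Im z))" for z
    unfolding Complex_eq by (auto intro!: derivative_eq_intros simp: scaleR_conv_of_real)
  \<comment> \<open>The first argument of \<open>F'' z\<close> is the direction in which
    \<open>F'\<close> is differentiated, so \<open>F'' z \<i> 1\<close> is the
    \<open>y\<close>-derivative of \<open>F' z 1\<close>.\<close>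
  have "mixed_derivs U F (\<lambda>z. F' z 1) (\<lambda>z. F' z \<i>) (\<lambda>z. F'' z \<i> 1)"
    unfolding mixed_derivs_def
  proof (intro conjI ballI)
    fix z assume z: "z \<in> U"
    show "((\<lambda>t. F (Complex t (Im z))) has_vector_derivative F' z 1) (at (Re z))"
      using has_derivative_compose[OF Re[of z], of F "F' z"] F'[OF z]
      by (simp add: has_vector_derivative_def blinfun.scaleR_right)
    show "((\<lambda>t. F (Complex (Re z) t)) has_vector_derivative F' z \<i>) (at (Im z))"
      using has_derivative_compose[OF Im[of z], of F "F' z"] F'[OF z]
      by (simp add: has_vector_derivative_def blinfun.scaleR_right)
    have "((\<lambda>w. F' w 1) has_derivative (\<lambda>h. F'' z h 1)) (at z)"
      using F''[OF z] by (auto intro!: derivative_eq_intros)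
    then have "((\<lambda>w. F' w 1) has_derivative (\<lambda>h. F'' z h 1)) (at (Complex (Re z) (Im z)))"
      by (simp add: complex_surj)
    from has_derivative_compose[OF Im[of z] this]
    show "((\<lambda>t. F' (Complex (Re z) t) 1) has_vector_derivative F'' z \<i> 1) (at (Im z))"
      by (simp add: has_vector_derivative_def blinfun.scaleR_right blinfun.scaleR_left)
  qed (use cont contF in \<open>auto intro!: continuous_intros\<close>)
  then show ?thesis by (rule that)
qed

section \<open>Cutoff functions\<close>

lemma C1_bump_exists:
  obtains B B' :: "real \<Rightarrow> real" where "\<And>t. (B has_real_derivative B' t) (at t)" "continuous_on UNIV B'"
    "\<And>t. \<bar>t\<bar> \<le> 1 \<Longrightarrow> B t = 1" "\<And>t. 2 \<le> \<bar>t\<bar> \<Longrightarrow> B t = 0"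
proof
  define P :: "real \<Rightarrow> real" where "P t = (max 0 t)\<^sup>2" for t
  have P: "(P has_real_derivative 2 * max 0 t) (at t)" for t
  proof (cases "t = 0")
    case True
    \<comment> \<open>At the junction of the two branches, the difference quotient is at most
      \<open>\<bar>h\<bar>\<close> in absolute value.\<close>
    have "((\<lambda>h. (P (0 + h) - P 0) / h) \<longlongrightarrow> 0) (at 0)"
    proof (rule Lim_null_comparison)
      show "\<forall>\<^sub>F h in at 0. norm ((P (0 + h) - P 0) / h) \<le> \<bar>h\<bar>"
        by (rule always_eventually) (auto simp: P_def max_def power2_eq_square)
      show "((\<lambda>h. \<bar>h\<bar>) \<longlongrightarrow> 0) (at (0::real))"
        by (rule tendsto_rabs_zero) (rule tendsto_ident_at)
    qed
    then show ?thesis by (simp add: True DERIV_def)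
  next
    case False
    show ?thesis
    proof (cases "0 < t")
      case True
      have "((\<lambda>t. t\<^sup>2) has_real_derivative 2 * max 0 t) (at t)"
        using True by (auto intro!: derivative_eq_intros)
      then show ?thesis
        by (rule has_field_derivative_transform_within_open[of _ _ _ "{0<..}"])
          (use True in \<open>auto simp: P_def\<close>)
    next
      case False
      have "((\<lambda>t. 0) has_real_derivative 2 * max 0 t) (at t)"
        using False by (auto simp: max_def)
      then show ?thesis
        by (rule has_field_derivative_transform_within_open[of _ _ _ "{..<0}"])
          (use False \<open>t \<noteq> 0\<close> in \<open>auto simp: P_def\<close>)
    qed
  qed
  \<comment> \<open>A quadratic spline rising from 0 to 1 on the unit interval. Its derivative is
    the tent of height 2 with corners at 0, 1/2 and 1, whose area is 1.\<close>
  define s where "s u = 2 * P u - 4 * P (u - 1/2) + 2 * P (u - 1)" for u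
  define s' where "s' u = 4 * max 0 u - 8 * max 0 (u - 1/2) + 4 * max 0 (u - 1)" for u :: real
  have s: "(s has_real_derivative s' u) (at u)" for u
    unfolding s_def s'_def by (rule derivative_eq_intros DERIV_chain2[OF P] refl)+ simp
  have s0: "s u = 0" if "u \<le> 0" for u
    using that by (simp add: s_def P_def)
  have s1: "s u = 1" if "1 \<le> u" for u
    using that by (simp add: s_def P_def power2_eq_square algebra_simps)
  \<comment> \<open>Both arguments are at least 1 for \<open>\<bar>t\<bar> \<le> 1\<close>, and one
    of them is at most 0 for \<open>2 \<le> \<bar>t\<bar>\<close>.\<close>
  show "((\<lambda>t. s (2 - t) * s (2 + t)) has_real_derivative s (2 - t) * s' (2 + t) - s' (2 - t) * s (2 + t)) (at t)" for t
    by (rule derivative_eq_intros DERIV_chain2[OF s] refl)+ simp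
  have "continuous_on UNIV s"
    using s by (meson DERIV_isCont continuous_at_imp_continuous_on)
  then have "continuous_on UNIV (\<lambda>t. s (2 - t))" "continuous_on UNIV (\<lambda>t. s (2 + t))"
    by (auto intro!: continuous_on_compose2[of UNIV s] continuous_intros)
  then show "continuous_on UNIV (\<lambda>t. s (2 - t) * s' (2 + t) - s' (2 - t) * s (2 + t))"
    unfolding s'_def by (intro continuous_intros)
  show "s (2 - t) * s (2 + t) = 1" if "\<bar>t\<bar> \<le> 1" for t
    using that by (simp add: s1)
  show "s (2 - t) * s (2 + t) = 0" if "2 \<le> \<bar>t\<bar>" for t
    using that by (cases "0 \<le> t") (simp_all add: s0)
qed

text \<open>Here \<eta> is one minus the usual cutoff. In this form a product of two such functions
  serves the union of the two sets, so finite covers are handled by induction.\<close>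

definition has_cutoff :: "complex set \<Rightarrow> complex set \<Rightarrow> bool" where
  "has_cutoff U V \<longleftrightarrow> (\<exists>\<eta> \<eta>x \<eta>y \<eta>xy C. mixed_derivs UNIV \<eta> \<eta>x \<eta>y \<eta>xy \<and> closed C \<and> C \<subseteq> U \<and>
    (\<forall>z\<in>V. \<eta> z = 0) \<and> (\<forall>z. z \<notin> C \<longrightarrow> \<eta> z = 1))"

lemma has_cutoff_empty: "has_cutoff U {}"
  unfolding has_cutoff_def using mixed_derivs_const[of UNIV 1] by blast

lemma has_cutoff_Un:
  assumes "has_cutoff U V" "has_cutoff U W"
  shows "has_cutoff U (V \<union> W)"
proof -
  obtain g gx gy gxy C where g: "mixed_derivs UNIV g gx gy gxy" "closed C" "C \<subseteq> U"
      "\<And>z. z \<in> V \<Longrightarrow> g z = 0" "\<And>z. z \<notin> C \<Longrightarrow> g z = 1"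
    using assms(1) unfolding has_cutoff_def by blast
  obtain h hx hy hxy D where h: "mixed_derivs UNIV h hx hy hxy" "closed D" "D \<subseteq> U"
      "\<And>z. z \<in> W \<Longrightarrow> h z = 0" "\<And>z. z \<notin> D \<Longrightarrow> h z = 1"
    using assms(2) unfolding has_cutoff_def by blast
  show ?thesis
    unfolding has_cutoff_def
    by (intro exI[of _ "C \<union> D"] exI conjI, rule mixed_derivs_mult[OF g(1) h(1)]) (use g h in auto)
qed

lemma has_cutoff_subset: "has_cutoff U V \<Longrightarrow> W \<subseteq> V \<Longrightarrow> has_cutoff U W"
  unfolding has_cutoff_def by blast

text \<open>One minus a tensor product of two rescaled bumps is 0 on the square of half side
  \<open>r\<close> around \<open>z0\<close> and 1 off the square of half side
  \<open>2 * r\<close>.\<close>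

lemma has_cutoff_nhd:
  assumes "open U" "z0 \<in> U"
  shows "\<exists>V. open V \<and> z0 \<in> V \<and> has_cutoff U V"
proof -
  obtain e where e: "0 < e" "cball z0 e \<subseteq> U"
    using assms open_contains_cball by blast
  \<comment> \<open>Points of the larger square satisfy
    \<open>cmod (z - z0) \<le> 2 * r + 2 * r = e\<close>.\<close>
  define r where "r = e / 4"
  have "0 < r" using e(1) by (simp add: r_def)
  obtain B B' :: "real \<Rightarrow> real" where B: "\<And>t. (B has_real_derivative B' t) (at t)" "continuous_on UNIV B'"
      "\<And>t. \<bar>t\<bar> \<le> 1 \<Longrightarrow> B t = 1" "\<And>t. 2 \<le> \<bar>t\<bar> \<Longrightarrow> B t = 0"
    using C1_bump_exists by blast
  define b where "b a t = complex_of_real (B ((t - a) / r))" for a t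
  define b' where "b' a t = complex_of_real (B' ((t - a) / r) / r)" for a t
  have "((\<lambda>t. B ((t - a) / r)) has_real_derivative B' ((t - a) / r) / r) (at t)" for a t
  proof -
    have "((\<lambda>t. (t - a) / r) has_real_derivative 1 / r) (at t)"
      using \<open>0 < r\<close> by (auto intro!: derivative_eq_intros)
    from DERIV_chain2[OF B(1) this] show ?thesis by simp
  qed
  then have b: "(b a has_vector_derivative b' a t) (at t)" for a t
    unfolding b_def b'_def by (intro has_vector_derivative_of_real) 
  have b': "continuous_on UNIV (b' a)" for a
    unfolding b'_def using \<open>0 < r\<close>
    by (intro continuous_intros continuous_on_compose2[OF B(2)]) auto
  define V where "V = {z. \<bar>Re z - Re z0\<bar> < r \<and> \<bar>Im z - Im z0\<bar> < r}"
  define C where "C = {z. \<bar>Re z - Re z0\<bar> \<le> 2 * r \<and> \<bar>Im z - Im z0\<bar> \<le> 2 * r}"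
  have "open V"
    unfolding V_def by (intro open_Collect_conj open_Collect_less continuous_intros)
  moreover have "z0 \<in> V"
    using \<open>0 < r\<close> by (simp add: V_def)
  moreover have "has_cutoff U V"
    unfolding has_cutoff_def
  proof (intro exI[of _ C] exI conjI)
    show "mixed_derivs UNIV (\<lambda>z. 1 - b (Re z0) (Re z) * b (Im z0) (Im z))
        (\<lambda>z. 0 - b' (Re z0) (Re z) * b (Im z0) (Im z)) (\<lambda>z. 0 - b (Re z0) (Re z) * b' (Im z0) (Im z))
        (\<lambda>z. 0 - b' (Re z0) (Re z) * b' (Im z0) (Im z))"
      by (intro mixed_derivs_diff mixed_derivs_const mixed_derivs_tensor b b')
    show "closed C"
      unfolding C_def by (intro closed_Collect_conj closed_Collect_le continuous_intros)
    show "C \<subseteq> U"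
    proof
      fix z assume "z \<in> C"
      then have "cmod (z - z0) \<le> e"
        using cmod_le[of "z - z0"] by (auto simp: C_def r_def)
      then show "z \<in> U"
        using e(2) by (auto simp: dist_norm norm_minus_commute)
    qed
    show "\<forall>z\<in>V. 1 - b (Re z0) (Re z) * b (Im z0) (Im z) = 0"
      using \<open>0 < r\<close> by (auto simp: V_def b_def B(3))
    show "\<forall>z. z \<notin> C \<longrightarrow> 1 - b (Re z0) (Re z) * b (Im z0) (Im z) = 1"
      using \<open>0 < r\<close> by (auto simp: C_def b_def not_le B(4) pos_le_divide_eq)
  qed
  ultimately show ?thesis by blast
qed

lemma has_cutoff_compact:
  assumes "open U" "compact K" "K \<subseteq> U"
  shows "has_cutoff U K"
proof -
  obtain V where V: "\<And>z. z \<in> U \<Longrightarrow> open (V z) \<and> z \<in> V z \<and> has_cutoff U (V z)"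
    using has_cutoff_nhd[OF assms(1)] by metis
  obtain T where T: "T \<subseteq> K" "finite T" "K \<subseteq> (\<Union>z\<in>T. V z)"
    by (rule compactE_image[OF assms(2), of K V]) (use V assms(3) in blast)+
  \<comment> \<open>The inclusion stays a premise so that the induction over the finite set
    \<open>T\<close> carries it along.\<close>
  from T(2) have "T \<subseteq> U \<Longrightarrow> has_cutoff U (\<Union>z\<in>T. V z)"
    by (induction) (auto simp: has_cutoff_empty V intro: has_cutoff_Un)
  with T assms(3) show ?thesis
    by (blast intro: has_cutoff_subset)
qed

text \<open>The function \<open>(1 - \<eta> z) * F z\<close> equals \<open>f\<close> on \<sigma>,
  where \<eta> is 0, and vanishes on \<open>U\<close> outside the closed set \<open>C\<close>, where
  \<eta> is 1. Hence it extends by zero.\<close>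

lemma C2_functions_extend:
  assumes "compact \<sigma>" "f \<in> C2_functions \<sigma>"
  obtains G Gx Gy Gxy where "mixed_derivs UNIV G Gx Gy Gxy" "\<And>z. z \<in> \<sigma> \<Longrightarrow> G z = f z"
proof -
  obtain U F where U: "open U" "\<sigma> \<subseteq> U" "C2_differentiable_on F U" "\<And>z. z \<in> \<sigma> \<Longrightarrow> F z = f z"
    using assms(2) unfolding C2_functions_def by blast
  obtain Fx Fy Fxy where F: "mixed_derivs U F Fx Fy Fxy"
    using C2_differentiable_mixed_derivs U by blast
  obtain \<eta> \<eta>x \<eta>y \<eta>xy C where \<eta>: "mixed_derivs UNIV \<eta> \<eta>x \<eta>y \<eta>xy" "closed C" "C \<subseteq> U"
      "\<And>z. z \<in> \<sigma> \<Longrightarrow> \<eta> z = 0" "\<And>z. z \<notin> C \<Longrightarrow> \<eta> z = 1"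
    using has_cutoff_compact[OF U(1) assms(1) U(2)] unfolding has_cutoff_def by blast
  note prod = mixed_derivs_mult[OF mixed_derivs_subset[OF mixed_derivs_diff[OF mixed_derivs_const[of UNIV 1] \<eta>(1)] subset_UNIV] F]
  have zero: "(1 - \<eta> z) * F z = 0" if "z \<in> U - C" for z
    using that \<eta>(5) by simp
  show ?thesis
    by (rule that[OF mixed_derivs_extend_zero[OF U(1) \<eta>(2,3) prod zero]]) (use U \<eta> in auto)
qed

subsection \<open>Polynomials in the two real coordinates\<close>

text \<open>Generation by monomials and sums lets antiderivatives be built by induction; the common
  degree bound required by \<open>P2\<close> is recovered in
  \<open>bipoly_coefficients\<close>.\<close>

inductive bipoly :: "(complex \<Rightarrow> complex) \<Rightarrow> bool" where
  monomial: "bipoly (\<lambda>z. c * of_real (Re z) ^ m * of_real (Im z) ^ n)"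
| add: "bipoly p \<Longrightarrow> bipoly q \<Longrightarrow> bipoly (\<lambda>z. p z + q z)"

lemma bipoly_const: "bipoly (\<lambda>z. c)"
  using bipoly.monomial[of c 0 0] by simp

lemma bipoly_mult_monomial:
  assumes "bipoly p"
  shows "bipoly (\<lambda>z. c * of_real (Re z) ^ m * of_real (Im z) ^ n * p z)"
  using assms
proof (induction rule: bipoly.induct)
  case (monomial d k l)
  show ?case
    using bipoly.monomial[of "c * d" "m + k" "n + l"] by (simp add: power_add ac_simps)
next
  case (add p q)
  then show ?case
    using bipoly.add[OF add.IH] by (simp add: distrib_left)
qed

lemma bipoly_mult:
  assumes "bipoly p" "bipoly q"
  shows "bipoly (\<lambda>z. p z * q z)"
  using assms(1)
proof (induction rule: bipoly.induct)
  case (monomial c m n)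
  show ?case by (rule bipoly_mult_monomial[OF assms(2)])
next
  case (add p p')
  then show ?case
    using bipoly.add[OF add.IH] by (simp add: distrib_right)
qed

text \<open>Translates the polynomials of the Stone-Weierstrass theorem, which are generated by
  real-linear functionals. Such a functional is determined by its values at \<open>1\<close> and
  \<open>\<i>\<close>.\<close>

lemma bipoly_of_real_polynomial_function:
  "real_polynomial_function f \<Longrightarrow> bipoly (\<lambda>z. of_real (f z))"
proof (induction rule: real_polynomial_function.induct)
  case (linear f)
  interpret bounded_linear f by fact
  have "f z = Re z * f 1 + Im z * f \<i>" for z
  proof -
    have "z = Re z *\<^sub>R 1 + Im z *\<^sub>R \<i>"
      by (simp add: complex_eq_iff)
    from arg_cong[OF this, of f] show ?thesis by (simp only: add scaleR real_scaleR_def)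
  qed
  from this[THEN arg_cong[of _ _ complex_of_real]]
  have "(\<lambda>z. complex_of_real (f z)) = (\<lambda>z. of_real (Re z * f 1 + Im z * f \<i>))"
    by (rule ext)
  moreover have "bipoly (\<lambda>z. of_real (Re z * f 1 + Im z * f \<i>))"
    using bipoly.add[OF bipoly.monomial[of "of_real (f 1)" 1 0] bipoly.monomial[of "of_real (f \<i>)" 0 1]]
    by (simp add: mult.commute)
  ultimately show ?case by (simp only:)
next
  case (const c)
  show ?case by (rule bipoly_const)
next
  case (add f g)
  then show ?case using bipoly.add[OF add.IH] by simp
next
  case (mult f g)
  then show ?case using bipoly_mult[OF mult.IH] by simp
qed

lemma Stone_Weierstrass_bipoly:
  assumes "compact K" "continuous_on K f" "0 < e"
  obtains p where "bipoly p" "\<And>z. z \<in> K \<Longrightarrow> cmod (f z - p z) < e"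
proof -
  obtain g where g: "polynomial_function g" "\<And>z. z \<in> K \<Longrightarrow> cmod (f z - g z) < e"
    using Stone_Weierstrass_polynomial_function[OF assms] by blast
  have "real_polynomial_function (Re \<circ> g)" "real_polynomial_function (Im \<circ> g)"
    using g(1) bounded_linear_Re bounded_linear_Im unfolding polynomial_function_def by blast+
  note parts = this[THEN bipoly_of_real_polynomial_function]
  have "bipoly (\<lambda>z. of_real (Re (g z)) + \<i> * of_real (Im (g z)))"
    using bipoly.add[OF parts(1) bipoly_mult[OF bipoly_const[of \<i>] parts(2)]] by simp
  then have "bipoly g"
    by (simp add: complex_eq[symmetric])
  from this g(2) show ?thesis by (rule that)
qed

text \<open>Allowing every \<open>K \<ge> N\<close> as degree bound makes the sum case immediate:
  both summands are expanded up to the same \<open>K\<close>.\<close>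

lemma bipoly_coefficients:
  assumes "bipoly p"
  shows "\<exists>c N. \<forall>K\<ge>N. \<forall>z. p z = (\<Sum>m\<le>K. \<Sum>n\<le>K. c m n * of_real (Re z) ^ m * of_real (Im z) ^ n)"
  using assms
proof (induction rule: bipoly.induct)
  case (monomial c k l)
  have "c * of_real (Re z) ^ k * of_real (Im z) ^ l =
      (\<Sum>m\<le>K. \<Sum>n\<le>K. (if m = k then if n = l then c else 0 else 0) * of_real (Re z) ^ m * of_real (Im z) ^ n)"
    if "max k l \<le> K" for K z
  proof -
    have "(\<Sum>n\<le>K. (if n = l then c else 0) * w * of_real (Im z) ^ n) = c * w * of_real (Im z) ^ l" for w
    proof -
      have "(\<Sum>n\<le>K. (if n = l then c else 0) * w * of_real (Im z) ^ n) =
          (\<Sum>n\<le>K. if n = l then c * w * of_real (Im z) ^ n else 0)"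
        by (intro sum.cong refl) simp
      then show ?thesis using that by simp
    qed
    then have "(\<Sum>m\<le>K. \<Sum>n\<le>K. (if m = k then if n = l then c else 0 else 0) * of_real (Re z) ^ m * of_real (Im z) ^ n) =
        (\<Sum>m\<le>K. if m = k then c * of_real (Re z) ^ m * of_real (Im z) ^ l else 0)"
      by (intro sum.cong refl) simp
    then show ?thesis using that by simp
  qed
  then show ?case
    by (intro exI[of _ "\<lambda>m n. if m = k then if n = l then c else 0 else 0"] exI[of _ "max k l"]) blast
next
  case (add p q)
  obtain c M where c: "\<forall>K\<ge>M. \<forall>z. p z = (\<Sum>m\<le>K. \<Sum>n\<le>K. c m n * of_real (Re z) ^ m * of_real (Im z) ^ n)"
    using add.IH(1) by blast
  obtain d N where d: "\<forall>K\<ge>N. \<forall>z. q z = (\<Sum>m\<le>K. \<Sum>n\<le>K. d m n * of_real (Re z) ^ m * of_real (Im z) ^ n)"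
    using add.IH(2) by blast
  show ?case
  proof (intro exI[of _ "\<lambda>m n. c m n + d m n"] exI[of _ "max M N"] allI impI)
    fix K z assume "max M N \<le> K"
    then have "p z + q z = (\<Sum>m\<le>K. \<Sum>n\<le>K. c m n * of_real (Re z) ^ m * of_real (Im z) ^ n) +
        (\<Sum>m\<le>K. \<Sum>n\<le>K. d m n * of_real (Re z) ^ m * of_real (Im z) ^ n)"
      using c[rule_format, of K z] d[rule_format, of K z] by simp
    then show "p z + q z = (\<Sum>m\<le>K. \<Sum>n\<le>K. (c m n + d m n) * of_real (Re z) ^ m * of_real (Im z) ^ n)"
      by (simp add: sum.distrib distrib_right)
  qed
qed

lemma bipoly_in_P2: "bipoly p \<Longrightarrow> p \<in> P2 \<sigma>"
  using bipoly_coefficients unfolding P2_def by blast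

section \<open>Antiderivatives of polynomials\<close>

text \<open>For \<open>n = 0\<close> the truncated exponent \<open>n - 1\<close> is harmless, since
  the factor \<open>of_nat n\<close> vanishes.\<close>

lemma has_vector_derivative_of_real_power:
  "((\<lambda>t. of_real t ^ n :: complex) has_vector_derivative of_nat n * of_real t ^ (n - 1)) (at t)"
  by (rule has_vector_derivative_real_field[of "\<lambda>w. w ^ n"]) (auto intro!: derivative_eq_intros)

lemma mixed_derivs_monomial:
  "mixed_derivs UNIV (\<lambda>z. c * of_real (Re z) ^ m * of_real (Im z) ^ n)
    (\<lambda>z. c * (of_nat m * of_real (Re z) ^ (m - 1)) * of_real (Im z) ^ n)
    (\<lambda>z. c * of_real (Re z) ^ m * (of_nat n * of_real (Im z) ^ (n - 1)))
    (\<lambda>z. c * (of_nat m * of_real (Re z) ^ (m - 1)) * (of_nat n * of_real (Im z) ^ (n - 1)))"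
  by (intro mixed_derivs_tensor has_vector_derivative_mult_right has_vector_derivative_of_real_power
      continuous_intros)

text \<open>Integrating a monomial in both variables raises both exponents. The
  \<open>x\<close>-derivative keeps a factor \<open>Im z\<close> and the \<open>y\<close>-derivative
  a factor \<open>Re z\<close>, so each vanishes on its axis.\<close>

lemma bipoly_antiderivative_mixed:
  assumes "bipoly q"
  shows "\<exists>p px py. bipoly p \<and> mixed_derivs UNIV p px py q \<and> p 0 = 0 \<and>
    (\<forall>x. px (Complex x 0) = 0) \<and> (\<forall>y. py (Complex 0 y) = 0)"
  using assms
proof (induction rule: bipoly.induct)
  case (monomial c m n)
  let ?c = "c / (of_nat (Suc m) * of_nat (Suc n))"
  have antiderivative: "mixed_derivs UNIV (\<lambda>z. ?c * of_real (Re z) ^ Suc m * of_real (Im z) ^ Suc n)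
      (\<lambda>z. ?c * (of_nat (Suc m) * of_real (Re z) ^ m) * of_real (Im z) ^ Suc n)
      (\<lambda>z. ?c * of_real (Re z) ^ Suc m * (of_nat (Suc n) * of_real (Im z) ^ n))
      (\<lambda>z. c * of_real (Re z) ^ m * of_real (Im z) ^ n)"
    using mixed_derivs_monomial[of ?c "Suc m" "Suc n"]
    by (simp add: field_simps del: of_nat_Suc)
  show ?case
    by (intro exI conjI, rule bipoly.monomial, rule antiderivative) simp_all
next
  case (add q q')
  then obtain p px py p' px' py' where
    p: "bipoly p" "mixed_derivs UNIV p px py q" "p 0 = 0"
      "\<And>x. px (Complex x 0) = 0" "\<And>y. py (Complex 0 y) = 0" and
    p': "bipoly p'" "mixed_derivs UNIV p' px' py' q'" "p' 0 = 0"
      "\<And>x. px' (Complex x 0) = 0" "\<And>y. py' (Complex 0 y) = 0"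
    by blast
  show ?case
    by (intro exI conjI, rule bipoly.add[OF p(1) p'(1)], rule mixed_derivs_add[OF p(2) p'(2)])
      (simp_all add: p p')
qed

text \<open>The restriction of \<open>q\<close> to the real axis is integrated in \<open>x\<close>.
  The result depends on \<open>Re z\<close> only, so its other derivatives are zero.\<close>

lemma bipoly_antiderivative_Re:
  assumes "bipoly q"
  shows "\<exists>p px. bipoly p \<and> mixed_derivs UNIV p px (\<lambda>z. 0) (\<lambda>z. 0) \<and> p 0 = 0 \<and>
    (\<forall>x. px (Complex x 0) = q (Complex x 0))"
  using assms
proof (induction rule: bipoly.induct)
  case (monomial c m n)
  \<comment> \<open>On the real axis a monomial with \<open>n > 0\<close> vanishes, so it
    contributes nothing.\<close>
  let ?c = "(if n = 0 then c / of_nat (Suc m) else 0)"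
  have antiderivative: "mixed_derivs UNIV (\<lambda>z. ?c * of_real (Re z) ^ Suc m * of_real (Im z) ^ 0)
      (\<lambda>z. ?c * (of_nat (Suc m) * of_real (Re z) ^ m) * of_real (Im z) ^ 0) (\<lambda>z. 0) (\<lambda>z. 0)"
    using mixed_derivs_monomial[of ?c "Suc m" 0] by (simp del: of_nat_Suc)
  show ?case
    by (intro exI conjI, rule bipoly.monomial, rule antiderivative) (simp_all del: of_nat_Suc)
next
  case (add q q')
  then obtain p px p' px' where
    p: "bipoly p" "mixed_derivs UNIV p px (\<lambda>z. 0) (\<lambda>z. 0)" "p 0 = 0"
      "\<And>x. px (Complex x 0) = q (Complex x 0)" and
    p': "bipoly p'" "mixed_derivs UNIV p' px' (\<lambda>z. 0) (\<lambda>z. 0)" "p' 0 = 0"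
      "\<And>x. px' (Complex x 0) = q' (Complex x 0)"
    by blast
  then show ?case
    using bipoly.add[OF p(1) p'(1)] mixed_derivs_add[OF p(2) p'(2)]
    by (intro exI[of _ "\<lambda>z. p z + p' z"] exI[of _ "\<lambda>z. px z + px' z"] conjI) simp_all
qed

text \<open>The mirror image, with the imaginary axis and the variable \<open>y\<close>.\<close>

lemma bipoly_antiderivative_Im:
  assumes "bipoly q"
  shows "\<exists>p py. bipoly p \<and> mixed_derivs UNIV p (\<lambda>z. 0) py (\<lambda>z. 0) \<and> p 0 = 0 \<and>
    (\<forall>y. py (Complex 0 y) = q (Complex 0 y))"
  using assms
proof (induction rule: bipoly.induct)
  case (monomial c m n)
  let ?c = "(if m = 0 then c / of_nat (Suc n) else 0)"
  have antiderivative: "mixed_derivs UNIV (\<lambda>z. ?c * of_real (Re z) ^ 0 * of_real (Im z) ^ Suc n) (\<lambda>z. 0)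
      (\<lambda>z. ?c * of_real (Re z) ^ 0 * (of_nat (Suc n) * of_real (Im z) ^ n)) (\<lambda>z. 0)"
    using mixed_derivs_monomial[of ?c 0 "Suc n"] by (simp del: of_nat_Suc)
  show ?case
    by (intro exI conjI, rule bipoly.monomial, rule antiderivative) (simp_all del: of_nat_Suc)
next
  case (add q q')
  then obtain p py p' py' where
    p: "bipoly p" "mixed_derivs UNIV p (\<lambda>z. 0) py (\<lambda>z. 0)" "p 0 = 0"
      "\<And>y. py (Complex 0 y) = q (Complex 0 y)" and
    p': "bipoly p'" "mixed_derivs UNIV p' (\<lambda>z. 0) py' (\<lambda>z. 0)" "p' 0 = 0"
      "\<And>y. py' (Complex 0 y) = q' (Complex 0 y)"
    by blast
  then show ?case
    using bipoly.add[OF p(1) p'(1)] mixed_derivs_add[OF p(2) p'(2)]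
    by (intro exI[of _ "\<lambda>z. p z + p' z"] exI[of _ "\<lambda>z. py z + py' z"] conjI) simp_all
qed

text \<open>A polynomial Goursat problem. Each of the three antiderivatives contributes to exactly
  one of the prescribed data \<open>a\<close>, \<open>b\<close>, \<open>q\<close> and vanishes at 0,
  so their sum plus \<open>c\<close> meets all conditions.\<close>

lemma bipoly_antiderivative:
  assumes "bipoly a" "bipoly b" "bipoly q"
  obtains p px py where "bipoly p" "mixed_derivs UNIV p px py q" "p 0 = c"
    "\<And>x. px (Complex x 0) = a (Complex x 0)" "\<And>y. py (Complex 0 y) = b (Complex 0 y)"
proof -
  obtain p px where p: "bipoly p" "mixed_derivs UNIV p px (\<lambda>z. 0) (\<lambda>z. 0)" "p 0 = 0"
      "\<And>x. px (Complex x 0) = a (Complex x 0)"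
    using bipoly_antiderivative_Re[OF assms(1)] by blast
  obtain r ry where r: "bipoly r" "mixed_derivs UNIV r (\<lambda>z. 0) ry (\<lambda>z. 0)" "r 0 = 0"
      "\<And>y. ry (Complex 0 y) = b (Complex 0 y)"
    using bipoly_antiderivative_Im[OF assms(2)] by blast
  obtain s sx sy where s: "bipoly s" "mixed_derivs UNIV s sx sy q" "s 0 = 0"
      "\<And>x. sx (Complex x 0) = 0" "\<And>y. sy (Complex 0 y) = 0"
    using bipoly_antiderivative_mixed[OF assms(3)] by blast
  show ?thesis
  proof (rule that)
    show "bipoly (\<lambda>z. ((p z + r z) + s z) + c)"
      by (intro bipoly.add bipoly_const p r s)
    show "mixed_derivs UNIV (\<lambda>z. ((p z + r z) + s z) + c) (\<lambda>z. px z + sx z) (\<lambda>z. ry z + sy z) q"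
      using mixed_derivs_add[OF mixed_derivs_add[OF mixed_derivs_add[OF p(2) r(2)] s(2)] mixed_derivs_const[of UNIV c]]
      by simp
  qed (use p r s in simp_all)
qed

subsection \<open>Density of polynomials\<close>

theorem theorem3p16:
  fixes \<sigma> :: "complex set"
  assumes "\<sigma> \<noteq> {}" and "compact \<sigma>"
  shows "C2_functions \<sigma> \<subseteq> AC \<sigma>"
proof
  fix f assume "f \<in> C2_functions \<sigma>"
  with assms(2) obtain G Gx Gy Gxy where G: "mixed_derivs UNIV G Gx Gy Gxy"
      and G_eq: "\<And>z. z \<in> \<sigma> \<Longrightarrow> G z = f z"
    using C2_functions_extend by blast
  have cont: "continuous_on K Gx" "continuous_on K Gy" "continuous_on K Gxy" for K
    using G unfolding mixed_derivs_def by (meson continuous_on_subset subset_UNIV)+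
  obtain L where "0 < L" and L: "\<And>z. z \<in> \<sigma> \<Longrightarrow> cmod z \<le> L"
    using compact_imp_bounded[OF assms(2)] unfolding bounded_pos by blast
  have \<sigma>: "\<bar>Re z\<bar> \<le> L \<and> \<bar>Im z\<bar> \<le> L" if "z \<in> \<sigma>" for z
    using L[OF that] abs_Re_le_cmod[of z] abs_Im_le_cmod[of z] by linarith
  \<comment> \<open>This square contains \<sigma> and the segments of both axes on which the norm
    estimate needs bounds.\<close>
  define Q where "Q = cbox (Complex (-L) (-L)) (Complex L L)"
  have "compact Q" by (simp add: Q_def)
  have Q: "Complex x y \<in> Q" if "\<bar>x\<bar> \<le> L" "\<bar>y\<bar> \<le> L" for x y
    using that by (auto simp: Q_def in_cbox_complex_iff)
  define C where "C = 1 + 6 * L * (1 + L)"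
  have "0 < C" using \<open>0 < L\<close> by (simp add: C_def pos_add_strict)
  note BV_le = BV_norm_le_mixed_derivs[where \<sigma> = \<sigma> and L = L, OF _ \<sigma>, folded C_def]
  have "BV_norm \<sigma> f < \<infinity>"
  proof -
    \<comment> \<open>A common bound for all the data of \<open>G\<close> on \<open>Q\<close> makes
      the norm estimate applicable to \<open>G\<close> itself.\<close>
    have "bounded (insert (G 0) (Gx ` Q \<union> Gy ` Q \<union> Gxy ` Q))"
      using compact_continuous_image[OF cont(1) \<open>compact Q\<close>] compact_continuous_image[OF cont(2) \<open>compact Q\<close>]
        compact_continuous_image[OF cont(3) \<open>compact Q\<close>]
      by (simp add: compact_imp_bounded)
    then obtain e where "0 < e" and e: "\<And>w. w \<in> insert (G 0) (Gx ` Q \<union> Gy ` Q \<union> Gxy ` Q) \<Longrightarrow> cmod w \<le> e"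
      unfolding bounded_pos by blast
    have "BV_norm \<sigma> G \<le> ennreal (e * C)"
      by (rule BV_le[OF G]) (use \<open>0 < L\<close> \<open>0 < e\<close> in \<open>auto intro!: e Q\<close>)
    then have "BV_norm \<sigma> G < \<infinity>"
      using ennreal_less_top order_le_less_trans by (metis infinity_ennreal_def)
    then show ?thesis
      using BV_norm_cong[of \<sigma> G f] G_eq by simp
  qed
  moreover have "\<exists>p\<in>P2 \<sigma>. BV_norm \<sigma> (\<lambda>z. f z - p z) < ennreal \<epsilon>" if "0 < \<epsilon>" for \<epsilon>
  proof -
    \<comment> \<open>Then \<open>e * C\<close> is half of \<epsilon>, which leaves room for the
      strict inequality.\<close>
    define e where "e = \<epsilon> / (2 * C)"
    have "0 < e" using \<open>0 < C\<close> that by (simp add: e_def)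
    obtain a where a: "bipoly a" "\<And>z. z \<in> Q \<Longrightarrow> cmod (Gx z - a z) < e"
      using Stone_Weierstrass_bipoly[OF \<open>compact Q\<close> cont(1) \<open>0 < e\<close>] by blast
    obtain b where b: "bipoly b" "\<And>z. z \<in> Q \<Longrightarrow> cmod (Gy z - b z) < e"
      using Stone_Weierstrass_bipoly[OF \<open>compact Q\<close> cont(2) \<open>0 < e\<close>] by blast
    obtain q where q: "bipoly q" "\<And>z. z \<in> Q \<Longrightarrow> cmod (Gxy z - q z) < e"
      using Stone_Weierstrass_bipoly[OF \<open>compact Q\<close> cont(3) \<open>0 < e\<close>] by blast
    \<comment> \<open>The data of \<open>p\<close> are the approximants, and its value at 0 is
      exact. So the data of \<open>G - p\<close> are at most \<open>e\<close> on the axes and on the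
      square.\<close>
    obtain p px py where p: "bipoly p" "mixed_derivs UNIV p px py q" "p 0 = G 0"
        "\<And>x. px (Complex x 0) = a (Complex x 0)" "\<And>y. py (Complex 0 y) = b (Complex 0 y)"
      using bipoly_antiderivative[OF a(1) b(1) q(1)] by metis
    have "BV_norm \<sigma> (\<lambda>z. f z - p z) = BV_norm \<sigma> (\<lambda>z. G z - p z)"
      by (rule BV_norm_cong) (simp add: G_eq)
    also have "\<dots> \<le> ennreal (e * C)"
      by (rule BV_le[OF mixed_derivs_diff[OF G p(2)]])
        (use \<open>0 < L\<close> \<open>0 < e\<close> p(3-5) in \<open>auto intro!: less_imp_le[OF a(2)] less_imp_le[OF b(2)] less_imp_le[OF q(2)] Q\<close>)
    also have "\<dots> < ennreal \<epsilon>"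
      using \<open>0 < C\<close> that by (intro ennreal_lessI) (auto simp: e_def)
    finally show ?thesis
      using bipoly_in_P2[OF p(1)] by blast
  qed
  ultimately show "f \<in> AC \<sigma>"
    by (simp add: AC_def BV_def)
qed

end
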